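(* Let $\gamma\in(0,1)$ and $\omega=\sqrt{1-\gamma^2}$, and write $\mathrm{sn},\mathrm{cn},\mathrm{dn}$ for the Jacobi elliptic functions $\mathrm{sn}(z;\gamma),\mathrm{cn}(z;\gamma),\mathrm{dn}(z;\gamma)$ of modulus $\gamma$. Then, with respect to the Lie bracket of meromorphic vector fields in one variable $z$: (1) $(J,P_1,P_2)=\left(-\frac{\mathrm{dn}}{\omega}\frac{d}{dz},\ \frac{i\,\mathrm{cn}}{\omega}\frac{d}{dz},\ i\,\mathrm{sn}\frac{d}{dz}\right)$ satisfies the elliptic Cayley-Klein relations, and the linear map determined by $$\frac{i}{\omega}\sigma_1^\gamma\mapsto -\frac{\mathrm{dn}}{\omega}\frac{d}{dz},\qquad i\sigma_2^\gamma\mapsto \frac{i\,\mathrm{cn}}{\omega}\frac{d}{dz},\qquad -\frac{i}{\omega}\sigma_3^\gamma\mapsto i\,\mathrm{sn}\frac{d}{dz}$$ is an isomorphism of real Lie algebras from the real span of the three matrices (with the matrix commutator) onto the real span of the three vector fields; (2) $(J,P_1,P_2)=\left(-\frac{\mathrm{dn}}{\omega}\frac{d}{dz},\ \frac{\mathrm{cn}}{\omega}\frac{d}{dz},\ \mathrm{sn}\frac{d}{dz}\right)$ satisfies the hyperbolic Cayley-Klein relations; (3) $(J,P_1,P_2)=\left(\frac{\mathrm{cn}}{\omega}\frac{d}{dz},\ \frac{\mathrm{dn}}{\omega}\frac{d}{dz},\ \mathrm{sn}\frac{d}{dz}\right)$ satisfies the co-hyperbolic Cayley-Klein relations; (4)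 $(J,P_1,P_2)=\left(\mathrm{sn}\frac{d}{dz},\ -\frac{i\,\mathrm{dn}}{\omega}\frac{d}{dz},\ \frac{i\,\mathrm{cn}}{\omega}\frac{d}{dz}\right)$ satisfies the doubly hyperbolic Cayley-Klein relations.
   Context: For meromorphic functions $f,g$ of one complex variable $z$, the Lie bracket of vector fields is $\left[f\frac{d}{dz},g\frac{d}{dz}\right]=\left(f\frac{dg}{dz}-g\frac{df}{dz}\right)\frac{d}{dz}$. The normalized 2-D Cayley-Klein relations with non-vanishing curvatures for a triple $(J,P_1,P_2)$ are: - elliptic: $[J,P_1]=P_2$, $[J,P_2]=-P_1$, $[P_1,P_2]=J$; - hyperbolic (Lobachevski): $[J,P_1]=P_2$, $[J,P_2]=-P_1$, $[P_1,P_2]=-J$; - co-hyperbolic (anti-de Sitter): $[J,P_1]=P_2$, $[J,P_2]=P_1$, $[P_1,P_2]=J$; - doubly hyperbolic (de Sitter): $[J,P_1]=P_2$, $[J,P_2]=P_1$, $[P_1,P_2]=-J$. The matrices are $$\sigma_1^\gamma=\tfrac12\begin{pmatrix}-i\gamma & 1\\ 1 & i\gamma\end{pmatrix},\quad \sigma_2^\gamma=\tfrac12\begin{pmatrix}0 & -i\\ i & 0\end{pmatrix},\quad \sigma_3^\gamma=\tfrac12\begin{pmatrix}1 & i\gamma\\ i\gamma & -1\end{pmatrix}.$$ The Jacobi elliptic functions of modulus $k$ are the meromorphic functions on $\mathbb{C}$ determined by $\mathrm{sn}'=\mathrm{cn}\,\mathrm{dn}$, $\mathrm{cn}'=-\mathrm{sn}\,\mathrm{dn}$,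 $\mathrm{dn}'=-k^2\,\mathrm{sn}\,\mathrm{cn}$ with $\mathrm{sn}(0)=0$, $\mathrm{cn}(0)=\mathrm{dn}(0)=1$; they satisfy $\mathrm{sn}^2+\mathrm{cn}^2=1=\mathrm{dn}^2+k^2\mathrm{sn}^2$. *)

theory Defs
  imports "HOL-Complex_Analysis.Complex_Analysis"
begin

section \<open>Meromorphic vector fields in one complex variable\<close>

text \<open>
  A meromorphic vector field \<open>f d/dz\<close> on the complex plane is given by its coefficient \<open>f\<close>.
  HOL functions are total, so a meromorphic function carries an irrelevant value at each pole
  (and may carry a wrong value at removable singularities); coefficients that agree off a
  discrete closed set are therefore identified.
\<close>

definition mero_eq :: "(complex \<Rightarrow> complex) \<Rightarrow> (complex \<Rightarrow> complex) \<Rightarrow> bool" where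
  "mero_eq f g \<longleftrightarrow> f meromorphic_on UNIV \<and> g meromorphic_on UNIV \<and> (\<forall>\<^sub>\<approx>z. f z = g z)"

lemma part_equivp_mero_eq: "part_equivp mero_eq"
proof (rule part_equivpI)
  show "\<exists>f. mero_eq f f"
    by (rule exI[of _ "\<lambda>_. 0"]) (auto simp: mero_eq_def)
  show "symp mero_eq"
    by (auto simp: symp_def mero_eq_def elim: eventually_mono)
  show "transp mero_eq"
    unfolding transp_def mero_eq_def by (auto elim: eventually_elim2)
qed

quotient_type mero_vf = "complex \<Rightarrow> complex" / partial: mero_eq
  by (rule part_equivp_mero_eq)

text \<open>
  The vector field \<open>f d/dz\<close>. It is meaningful only for meromorphic \<open>f\<close>; other coefficients
  are mapped to the zero field.
\<close>

lift_definition ddz :: "(complex \<Rightarrow> complex) \<Rightarrow> mero_vf" is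
  "\<lambda>f. if f meromorphic_on UNIV then f else (\<lambda>_. 0)"
  by (auto simp: mero_eq_def)

lemma eventually_deriv_eq_cosparse:
  assumes "\<forall>\<^sub>\<approx>z. f z = (g z :: complex)"
  shows "\<forall>\<^sub>\<approx>z. deriv f z = deriv g z"
proof -
  define X where "X = {z. f z \<noteq> g z}"
  have X: "X sparse_in UNIV"
    using assms by (simp add: eventually_cosparse X_def)
  have op: "open (- X)"
    using sparse_in_UNIV_imp_closed[OF X] by (simp add: open_Compl)
  have "deriv f z = deriv g z" if "z \<notin> X" for z
    by (rule deriv_cong_ev[OF _ refl])
       (use eventually_nhds_in_open[OF op, of z] that in \<open>auto elim!: eventually_mono simp: X_def\<close>)
  with eventually_not_in_cosparse[OF X] show ?thesis
    by (auto elim: eventually_mono)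
qed

instantiation mero_vf :: real_vector
begin

lift_definition zero_mero_vf :: mero_vf is "\<lambda>_. 0"
  by (auto simp: mero_eq_def)

lift_definition plus_mero_vf :: "mero_vf \<Rightarrow> mero_vf \<Rightarrow> mero_vf" is "\<lambda>f g z. f z + g z"
  by (auto simp: mero_eq_def intro!: meromorphic_intros elim: eventually_elim2)

lift_definition uminus_mero_vf :: "mero_vf \<Rightarrow> mero_vf" is "\<lambda>f z. - f z"
  by (auto simp: mero_eq_def intro!: meromorphic_intros elim: eventually_mono)

lift_definition minus_mero_vf :: "mero_vf \<Rightarrow> mero_vf \<Rightarrow> mero_vf" is "\<lambda>f g z. f z - g z"
  by (auto simp: mero_eq_def intro!: meromorphic_intros elim: eventually_elim2)

lift_definition scaleR_mero_vf :: "real \<Rightarrow> mero_vf \<Rightarrow> mero_vf" is "\<lambda>r f z. r *\<^sub>R f z"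
  by (auto simp: mero_eq_def intro!: meromorphic_intros elim: eventually_mono)

instance
  by standard
     (transfer, auto simp: mero_eq_def algebra_simps intro!: meromorphic_intros)+

end

lift_definition vf_bracket :: "mero_vf \<Rightarrow> mero_vf \<Rightarrow> mero_vf" is
  "\<lambda>f g z. f z * deriv g z - g z * deriv f z"
proof -
  fix f f' g g' :: "complex \<Rightarrow> complex"
  assume "mero_eq f f'" "mero_eq g g'"
  then have m: "f meromorphic_on UNIV" "f' meromorphic_on UNIV"
      "g meromorphic_on UNIV" "g' meromorphic_on UNIV"
    and e: "\<forall>\<^sub>\<approx>z. f z = f' z" "\<forall>\<^sub>\<approx>z. g z = g' z"
    by (auto simp: mero_eq_def)
  have "\<forall>\<^sub>\<approx>z. f z * deriv g z - g z * deriv f z = f' z * deriv g' z - g' z * deriv f' z"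
    using e eventually_deriv_eq_cosparse[OF e(1)] eventually_deriv_eq_cosparse[OF e(2)]
    by eventually_elim simp
  with m show "mero_eq (\<lambda>z. f z * deriv g z - g z * deriv f z)
      (\<lambda>z. f' z * deriv g' z - g' z * deriv f' z)"
    by (auto simp: mero_eq_def intro!: meromorphic_intros)
qed


section \<open>Real Lie algebras\<close>

definition linear_map_on :: "'a::real_vector set \<Rightarrow> ('a \<Rightarrow> 'b::real_vector) \<Rightarrow> bool" where
  "linear_map_on V h \<longleftrightarrow>
     (\<forall>x\<in>V. \<forall>y\<in>V. h (x + y) = h x + h y) \<and> (\<forall>r. \<forall>x\<in>V. h (r *\<^sub>R x) = r *\<^sub>R h x)"

definition real_lie_algebra :: "'a::real_vector set \<Rightarrow> ('a \<Rightarrow> 'a \<Rightarrow> 'a) \<Rightarrow> bool" where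
  "real_lie_algebra L br \<longleftrightarrow>
     subspace L \<and>
     (\<forall>x\<in>L. \<forall>y\<in>L. br x y \<in> L) \<and>
     (\<forall>x\<in>L. linear_map_on L (br x)) \<and>
     (\<forall>y\<in>L. linear_map_on L (\<lambda>x. br x y)) \<and>
     (\<forall>x\<in>L. br x x = 0) \<and>
     (\<forall>x\<in>L. \<forall>y\<in>L. \<forall>z\<in>L. br x (br y z) + br y (br z x) + br z (br x y) = 0)"

definition real_lie_algebra_iso ::
    "'a::real_vector set \<Rightarrow> ('a \<Rightarrow> 'a \<Rightarrow> 'a) \<Rightarrow>
     'b::real_vector set \<Rightarrow> ('b \<Rightarrow> 'b \<Rightarrow> 'b) \<Rightarrow> ('a \<Rightarrow> 'b) \<Rightarrow> bool" where
  "real_lie_algebra_iso L br L' br' h \<longleftrightarrow>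
     real_lie_algebra L br \<and> real_lie_algebra L' br' \<and>
     linear_map_on L h \<and> bij_betw h L L' \<and>
     (\<forall>x\<in>L. \<forall>y\<in>L. h (br x y) = br' (h x) (h y))"


section \<open>Cayley-Klein relations\<close>

definition elliptic_CK :: "('a::ab_group_add \<Rightarrow> 'a \<Rightarrow> 'a) \<Rightarrow> 'a \<Rightarrow> 'a \<Rightarrow> 'a \<Rightarrow> bool" where
  "elliptic_CK br J P1 P2 \<longleftrightarrow> br J P1 = P2 \<and> br J P2 = - P1 \<and> br P1 P2 = J"

definition hyperbolic_CK :: "('a::ab_group_add \<Rightarrow> 'a \<Rightarrow> 'a) \<Rightarrow> 'a \<Rightarrow> 'a \<Rightarrow> 'a \<Rightarrow> bool" where
  "hyperbolic_CK br J P1 P2 \<longleftrightarrow> br J P1 = P2 \<and> br J P2 = - P1 \<and> br P1 P2 = - J"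

definition co_hyperbolic_CK :: "('a::ab_group_add \<Rightarrow> 'a \<Rightarrow> 'a) \<Rightarrow> 'a \<Rightarrow> 'a \<Rightarrow> 'a \<Rightarrow> bool" where
  "co_hyperbolic_CK br J P1 P2 \<longleftrightarrow> br J P1 = P2 \<and> br J P2 = P1 \<and> br P1 P2 = J"

definition doubly_hyperbolic_CK :: "('a::ab_group_add \<Rightarrow> 'a \<Rightarrow> 'a) \<Rightarrow> 'a \<Rightarrow> 'a \<Rightarrow> 'a \<Rightarrow> bool" where
  "doubly_hyperbolic_CK br J P1 P2 \<longleftrightarrow> br J P1 = P2 \<and> br J P2 = P1 \<and> br P1 P2 = - J"


section \<open>The matrices\<close>

definition cmat_scale :: "complex \<Rightarrow> complex^2^2 \<Rightarrow> complex^2^2" (infixr \<open>*\<^sub>\<complex>\<close> 75) where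
  "c *\<^sub>\<complex> A = map_matrix ((*) c) A"

definition commutator :: "complex^2^2 \<Rightarrow> complex^2^2 \<Rightarrow> complex^2^2" where
  "commutator A B = A ** B - B ** A"

definition sigma1 :: "real \<Rightarrow> complex^2^2" where
  "sigma1 \<gamma> = (1/2) *\<^sub>\<complex> vector [vector [- \<i> * of_real \<gamma>, 1],
                                 vector [1, \<i> * of_real \<gamma>]]"

text \<open>The second matrix does not involve the modulus; the argument is kept for uniformity.\<close>

definition sigma2 :: "real \<Rightarrow> complex^2^2" where
  "sigma2 \<gamma> = (1/2) *\<^sub>\<complex> vector [vector [0, - \<i>],
                                 vector [\<i>, 0]]"

definition sigma3 :: "real \<Rightarrow> complex^2^2" where
  "sigma3 \<gamma> = (1/2) *\<^sub>\<complex> vector [vector [1, \<i> * of_real \<gamma>],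
                                 vector [\<i> * of_real \<gamma>, - 1]]"


section \<open>Jacobi elliptic functions\<close>

text \<open>
  The triple of functions \<open>(sn, cn, dn)\<close> of modulus \<open>k\<close> is characterised as the meromorphic
  solution on the plane of the defining system of differential equations. The equations hold
  off a discrete closed set (the poles). Analyticity at \<open>0\<close> makes the initial values
  meaningful. Up to their values at poles and removable singularities, the three functions are
  uniquely determined. The quadratic identities between them are consequences and not part of
  the definition.
\<close>

definition jacobi_elliptic ::
    "complex \<Rightarrow> (complex \<Rightarrow> complex) \<Rightarrow> (complex \<Rightarrow> complex) \<Rightarrow> (complex \<Rightarrow> complex) \<Rightarrow> bool" where
  "jacobi_elliptic k sn cn dn \<longleftrightarrow>
     sn meromorphic_on UNIV \<and> cn meromorphic_on UNIV \<and> dn meromorphic_on UNIV \<and>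
     sn analytic_on {0} \<and> cn analytic_on {0} \<and> dn analytic_on {0} \<and>
     sn 0 = 0 \<and> cn 0 = 1 \<and> dn 0 = 1 \<and>
     (\<forall>\<^sub>\<approx>z. (sn has_field_derivative cn z * dn z) (at z)) \<and>
     (\<forall>\<^sub>\<approx>z. (cn has_field_derivative - sn z * dn z) (at z)) \<and>
     (\<forall>\<^sub>\<approx>z. (dn has_field_derivative - k\<^sup>2 * sn z * cn z) (at z))"

end

theory Submission
  imports Defs
begin

text \<open>
  The quadratic identities hold because both sides have zero derivative off a discrete closed set,
  whose complement is connected; all brackets of \<open>sn\<close>, \<open>cn\<close>, \<open>dn\<close> follow from them. For the isomorphism,
  mapping the standard basis of \<open>real^3\<close> to an elliptic triple of a bilinear alternating bracket
  turns the cross product into that bracket. Since the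
  cross product algebra is simple, the resulting map is injective as soon as \<open>J \<noteq> 0\<close>. Hence both
  spans are copies of the cross product algebra; in particular the Jacobi identity needs no
  second derivatives and linear independence needs no analysis beyond \<open>dn 0 = 1\<close>.
\<close>

section \<open>Elliptic triples and the cross product\<close>

text \<open>This provides the way back from a span to its coordinates. The local fact
  \<open>kI\<close> reduces each identity for the inverse to applying \<open>h\<close> to the
  claimed value.\<close>

lemma real_lie_algebra_iso_sym:
  assumes "real_lie_algebra_iso L br L' br' h"
  shows "real_lie_algebra_iso L' br' L br (inv_into L h)"
proof -
  let ?k = "inv_into L h"
  have L: "subspace L" "\<And>x y. x \<in> L \<Longrightarrow> y \<in> L \<Longrightarrow> br x y \<in> L" and
    bij: "bij_betw h L L'" and
    add: "\<And>x y. x \<in> L \<Longrightarrow> y \<in> L \<Longrightarrow> h (x + y) = h x + h y" and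
    scale: "\<And>r x. x \<in> L \<Longrightarrow> h (r *\<^sub>R x) = r *\<^sub>R h x" and
    hom: "\<And>x y. x \<in> L \<Longrightarrow> y \<in> L \<Longrightarrow> h (br x y) = br' (h x) (h y)"
    using assms by (auto simp: real_lie_algebra_iso_def real_lie_algebra_def linear_map_on_def)
  have k: "?k x \<in> L" "h (?k x) = x" if "x \<in> L'" for x
    using bij that by (metis bij_betw_imp_surj_on inv_into_into, metis bij_betw_inv_into_right)
  have kI: "?k x = y" if "y \<in> L" "h y = x" for x y
    using bij that by (metis bij_betw_inv_into_left)
  have "linear_map_on L' ?k"
    unfolding linear_map_on_def
    by (auto intro!: kI simp: k add scale L(1) subspace_add subspace_scale)
  moreover have "?k (br' x y) = br (?k x) (?k y)" if "x \<in> L'" "y \<in> L'" for x y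
    using that by (intro kI) (auto simp: k hom L(2))
  ultimately show ?thesis
    using assms bij_betw_inv_into[OF bij] by (auto simp: real_lie_algebra_iso_def)
qed

lemma real_lie_algebra_iso_trans:
  assumes "real_lie_algebra_iso L br L' br' h" "real_lie_algebra_iso L' br' L'' br'' h'"
  shows "real_lie_algebra_iso L br L'' br'' (h' \<circ> h)"
proof -
  have "h x \<in> L'" if "x \<in> L" for x
    using assms(1) that by (auto simp: real_lie_algebra_iso_def bij_betw_def)
  then show ?thesis
    using assms by (auto simp: real_lie_algebra_iso_def linear_map_on_def intro: bij_betw_trans)
qed

text \<open>\<open>linear_map_on\<close> says nothing about values off the set, so the induction
  carries membership in the span along. It justifies speaking of the map determined by its values on
  generators.\<close>

lemma linear_map_on_span_unique:
  assumes "linear_map_on (span S) f" "linear_map_on (span S) g"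
    and "\<And>x. x \<in> S \<Longrightarrow> f x = g x" and "x \<in> span S"
  shows "f x = g x"
proof -
  have lin: "k (c *\<^sub>R x + y) = c *\<^sub>R k x + k y"
    if "linear_map_on (span S) k" "x \<in> span S" "y \<in> span S" for k :: "'a \<Rightarrow> 'b" and c x y
    using that by (simp add: linear_map_on_def span_scale)
  from assms(4) have "x \<in> span S \<and> f x = g x"
  proof (induction rule: span_induct_alt)
    case base
    show ?case
      \<comment> \<open>With \<open>c = 1\<close> and both vectors zero, linearity reads
        \<open>k 0 = k 0 + k 0\<close>, so both maps vanish at \<open>0\<close>.\<close>
      using lin[OF assms(1) span_zero span_zero, of 1] lin[OF assms(2) span_zero span_zero, of 1]
      by (simp add: span_zero)
  next
    case (step c x y)
    then have "x \<in> span S" "y \<in> span S"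
      by (auto intro: span_base)
    with step assms(3) lin[OF assms(1) this] lin[OF assms(2) this] show ?case
      by (simp add: span_add span_scale)
  qed
  then show ?thesis ..
qed

definition frame_map :: "'a::real_vector \<Rightarrow> 'a \<Rightarrow> 'a \<Rightarrow> real^3 \<Rightarrow> 'a" where
  "frame_map J P Q u = u$1 *\<^sub>R J + u$2 *\<^sub>R P + u$3 *\<^sub>R Q"

lemma range_frame_map: "range (frame_map J P Q) = span {J, P, Q}"
proof (intro equalityI subsetI)
  fix x assume "x \<in> span {J, P, Q}"
  then obtain a b c where "x = a *\<^sub>R J + b *\<^sub>R P + c *\<^sub>R Q"
    by (auto simp: span_breakdown_eq algebra_simps)
  then have "x = frame_map J P Q (vector [a, b, c])"
    by (simp add: frame_map_def)
  then show "x \<in> range (frame_map J P Q)" by blast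
next
  fix x assume "x \<in> range (frame_map J P Q)"
  then show "x \<in> span {J, P, Q}"
    by (force simp: frame_map_def intro: span_add span_scale span_base)
qed

text \<open>The elliptic relations are those of the standard basis under the cross product:
  \<open>e1 x e2 = e3\<close>, \<open>e1 x e3 = - e2\<close>, \<open>e2 x e3 = e1\<close>.
  Alternation supplies the reversed brackets, and bilinear expansion does the rest.\<close>

lemma frame_map_cross3:
  assumes br: "bilinear br" "\<And>x. br x x = 0" and CK: "elliptic_CK br J P Q"
  shows "br (frame_map J P Q u) (frame_map J P Q v) = frame_map J P Q (cross3 u v)"
proof -
  have antisym: "br y x = - br x y" for x y
  proof -
    have "0 = br (x + y) (x + y)" using br(2) by simp
    also have "\<dots> = br x y + br y x"
      by (simp add: bilinear_ladd[OF br(1)] bilinear_radd[OF br(1)] br(2)[of x] br(2)[of y])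
    finally show ?thesis by (metis eq_neg_iff_add_eq_0 add.commute)
  qed
  have "br J P = Q" "br J Q = - P" "br P Q = J"
    using CK by (auto simp: elliptic_CK_def)
  with antisym[of P J] antisym[of Q J] antisym[of Q P]
  have "br P J = - Q" "br Q J = P" "br Q P = - J"
    by simp_all
  with \<open>br J P = Q\<close> \<open>br J Q = - P\<close> \<open>br P Q = J\<close> show ?thesis
    by (simp add: frame_map_def cross3_def br(2) bilinear_ladd[OF br(1)] bilinear_radd[OF br(1)]
        bilinear_lmul[OF br(1)] bilinear_rmul[OF br(1)] algebra_simps)
qed

lemma inj_frame_map:
  assumes br: "bilinear br" "\<And>x. br x x = 0" and CK: "elliptic_CK br J P Q" and "J \<noteq> 0"
  shows "inj (frame_map J P Q)"
proof -
  let ?F = "frame_map J P Q"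
  \<comment> \<open>The kernel is an ideal of the cross product algebra.\<close>
  have zero: "?F (cross3 v u) = 0" if "?F u = 0" for u v
    using frame_map_cross3[OF br CK, of v u] that by (simp add: bilinear_rzero[OF br(1)])
  have "u = 0" if "?F u = 0" for u
  proof -
    text \<open>Two cross products with basis vectors isolate a single coordinate in front of \<open>J\<close>.\<close>
    have "?F (cross3 (vector [0,1,0]) (cross3 (vector [1,0,0]) u)) = 0"
      "?F (cross3 (vector [0,0,1]) (cross3 (vector [1,0,0]) u)) = 0"
      using that zero by blast+
    then have "u$2 = 0" "u$3 = 0"
      using \<open>J \<noteq> 0\<close> by (simp_all add: frame_map_def cross3_def)
    with that \<open>J \<noteq> 0\<close> have "u$1 = 0" by (simp add: frame_map_def)
    with \<open>u$2 = 0\<close> \<open>u$3 = 0\<close> show ?thesis by (simp add: vec_eq_iff forall_3)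
  qed
  moreover have "linear ?F"
    by (auto simp: frame_map_def algebra_simps intro!: linearI)
  ultimately show ?thesis by (simp add: linear_injective_0)
qed

lemma real_lie_algebra_iso_frame_map:
  assumes br: "bilinear br" "\<And>x. br x x = 0" and CK: "elliptic_CK br J P Q" and J: "J \<noteq> 0"
  shows "real_lie_algebra_iso UNIV cross3 (span {J, P, Q}) br (frame_map J P Q)"
proof -
  let ?F = "frame_map J P Q"
  note hom = frame_map_cross3[OF br CK]
  have add: "?F (u + v) = ?F u + ?F v" for u v
    by (simp add: frame_map_def algebra_simps)
  have scale: "?F (r *\<^sub>R u) = r *\<^sub>R ?F u" for r u
    by (simp add: frame_map_def algebra_simps)
  have zero: "?F 0 = 0" by (simp add: frame_map_def)
  have "real_lie_algebra UNIV cross3"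
    by (auto simp: real_lie_algebra_def linear_map_on_def Jacobi
        cross_add_left cross_add_right cross_mult_left cross_mult_right)
  \<comment> \<open>Each nested bracket is \<open>?F\<close> of a nested cross product, so the
    Jacobi sum is the image of the one for \<open>cross3\<close>, which is zero.\<close>
  moreover have "br (?F u) (br (?F v) (?F w)) + br (?F v) (br (?F w) (?F u))
      + br (?F w) (br (?F u) (?F v)) = 0" for u v w
    by (simp only: hom Jacobi zero flip: add)
  then have "real_lie_algebra (range ?F) br"
    using subspace_span[of "{J, P, Q}", folded range_frame_map[of J P Q]]
    by (auto simp: real_lie_algebra_def linear_map_on_def hom br(2) bilinear_ladd[OF br(1)]
        bilinear_radd[OF br(1)] bilinear_lmul[OF br(1)] bilinear_rmul[OF br(1)])
  ultimately show ?thesis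
    using inj_frame_map[OF br CK J]
    by (auto simp: real_lie_algebra_iso_def linear_map_on_def bij_betw_def add scale hom
        simp flip: range_frame_map)
qed

lemma elliptic_CK_span_iso:
  assumes br: "bilinear br" "\<And>x. br x x = 0" "elliptic_CK br A B C" "A \<noteq> 0"
    and br': "bilinear br'" "\<And>x. br' x x = 0" "elliptic_CK br' J P Q" "J \<noteq> 0"
  obtains h where "real_lie_algebra_iso (span {A, B, C}) br (span {J, P, Q}) br' h"
    and "h A = J" "h B = P" "h C = Q"
proof
  let ?F = "frame_map A B C" and ?G = "frame_map J P Q"
  show "real_lie_algebra_iso (span {A, B, C}) br (span {J, P, Q}) br' (?G \<circ> inv ?F)"
    using real_lie_algebra_iso_trans[OF real_lie_algebra_iso_sym]
      real_lie_algebra_iso_frame_map[OF br] real_lie_algebra_iso_frame_map[OF br'] by blast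
  have inv: "inv ?F (?F u) = u" for u
    using inj_frame_map[OF br] by (rule inv_f_f)
  show "(?G \<circ> inv ?F) A = J" "(?G \<circ> inv ?F) B = P" "(?G \<circ> inv ?F) C = Q"
    \<comment> \<open>The frame vectors are the images of the standard basis, so the composite sends
      each one to the vector with the same coordinates in the other frame.\<close>
    using inv[of "vector [1,0,0]"] inv[of "vector [0,1,0]"] inv[of "vector [0,0,1]"]
    by (simp_all add: frame_map_def)
qed


section \<open>Matrices\<close>

lemma bilinear_commutator: "bilinear commutator"
  by (auto simp: bilinear_def commutator_def matrix_matrix_mult_def vec_eq_iff sum_2
      algebra_simps intro!: linearI)

lemma commutator_self [simp]: "commutator A A = 0"
  by (simp add: commutator_def)

text \<open>In terms of Pauli matrices \<open>X\<close>, \<open>Y\<close>, \<open>Z\<close>, the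
  three matrices are \<open>(X - i \<gamma> Z)/2\<close>, \<open>Y/2\<close> and
  \<open>(Z + i \<gamma> X)/2\<close>. The relation between \<open>\<omega>\<close> and
  \<open>\<gamma>\<close> enters through the bracket of the first and third, which is
  \<open>- i (1 - \<gamma>^2)\<close> times the second; the two factors \<open>1 / \<omega>\<close>
  cancel it.\<close>

lemma elliptic_CK_sigma:
  assumes "\<omega>\<^sup>2 = 1 - \<gamma>\<^sup>2" "\<omega> \<noteq> 0"
  shows "elliptic_CK commutator ((\<i> / of_real \<omega>) *\<^sub>\<complex> sigma1 \<gamma>) (\<i> *\<^sub>\<complex> sigma2 \<gamma>)
           ((- \<i> / of_real \<omega>) *\<^sub>\<complex> sigma3 \<gamma>)"
proof -
  have "(of_real \<gamma>)\<^sup>2 + (of_real \<omega>)\<^sup>2 = (1 :: complex)"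
    using assms(1) by (simp flip: of_real_power of_real_add)
  \<comment> \<open>The trailing factor \<open>x\<close> puts the identity into the right-nested
    form in which products appear after clearing denominators.\<close>
  then have w: "of_real \<gamma> * (of_real \<gamma> * x) + of_real \<omega> * (of_real \<omega> * x) = x" for x :: complex
    by algebra
  show ?thesis
    using assms(2)
    by (simp add: elliptic_CK_def commutator_def cmat_scale_def sigma1_def sigma2_def sigma3_def
        map_matrix_def matrix_matrix_mult_def vec_eq_iff sum_2 forall_2 field_simps w)
qed

lemma sigma1_multiple_nonzero: "c \<noteq> 0 \<Longrightarrow> c *\<^sub>\<complex> sigma1 \<gamma> \<noteq> 0"
  by (auto simp: cmat_scale_def sigma1_def map_matrix_def vec_eq_iff forall_2)


section \<open>Brackets of vector fields\<close>

lemma ddz_eqI: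
  assumes "f meromorphic_on UNIV" "g meromorphic_on UNIV" "\<forall>\<^sub>\<approx>z. f z = g z"
  shows "ddz f = ddz g"
  using assms by transfer (simp add: mero_eq_def)

lemma uminus_ddz: "f meromorphic_on UNIV \<Longrightarrow> - ddz f = ddz (\<lambda>z. - f z)"
  by transfer (auto simp: mero_eq_def intro!: meromorphic_intros)

text \<open>A zero field only forces \<open>f\<close> to vanish off a discrete set, which a single
  nonzero value does not contradict. Continuity spreads that value to a punctured neighbourhood of
  \<open>a\<close>, where both claims would have to hold.\<close>

lemma ddz_nonzero:
  assumes "f meromorphic_on UNIV" "isCont f a" "f a \<noteq> 0"
  shows "ddz f \<noteq> 0"
proof
  assume "ddz f = 0"
  with assms(1) have "\<forall>\<^sub>\<approx>z. f z = 0"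
    by transfer (auto simp: mero_eq_def)
  then have "eventually (\<lambda>z. f z = 0) (at a)"
    by (rule eventually_cosparse_imp_eventually_at) auto
  moreover have "eventually (\<lambda>z. f z \<noteq> 0) (at a)"
    using assms(2,3) by (simp add: isCont_def tendsto_imp_eventually_ne)
  ultimately have "eventually (\<lambda>z::complex. False) (at a)"
    by eventually_elim simp
  then show False by simp
qed

lemma vf_bracket_ddz:
  assumes "f meromorphic_on UNIV" "g meromorphic_on UNIV" "h meromorphic_on UNIV"
    and "\<forall>\<^sub>\<approx>z. (f has_field_derivative f' z) (at z)" "\<forall>\<^sub>\<approx>z. (g has_field_derivative g' z) (at z)"
    and "\<forall>\<^sub>\<approx>z. f z * g' z - g z * f' z = h z"
  shows "vf_bracket (ddz f) (ddz g) = ddz h"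
proof -
  have "\<forall>\<^sub>\<approx>z. f z * deriv g z - g z * deriv f z = h z"
    using assms(4-6) by eventually_elim (simp add: DERIV_imp_deriv)
  with assms(1-3) show ?thesis
    by transfer (auto simp: mero_eq_def intro!: meromorphic_intros)
qed

lemma eventually_field_differentiable_cosparse:
  assumes "f meromorphic_on UNIV"
  shows "\<forall>\<^sub>\<approx>z. f field_differentiable at z"
  using meromorphic_on_imp_analytic_cosparse[OF assms]
  by eventually_elim (auto intro: analytic_on_imp_differentiable_at)

lemma vf_bracket_self [simp]: "vf_bracket x x = 0"
  by transfer (auto simp: mero_eq_def intro!: meromorphic_intros)

lemma vf_bracket_antisym: "vf_bracket x y = - vf_bracket y x"
  by transfer (auto simp: mero_eq_def intro!: meromorphic_intros)

text \<open>The rules for \<open>deriv\<close> of a sum or a multiple require differentiability,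
  which may fail at poles. The identities therefore hold off a discrete set, and the quotient asks
  for no more. Antisymmetry handles the first argument.\<close>

lemma bilinear_vf_bracket: "bilinear vf_bracket"
proof -
  have "linear (vf_bracket x)" for x
  proof (rule linearI)
    fix y z
    show "vf_bracket x (y + z) = vf_bracket x y + vf_bracket x z"
    proof transfer
      fix f g h
      assume "mero_eq f f" "mero_eq g g" "mero_eq h h"
      then have m: "f meromorphic_on UNIV" "g meromorphic_on UNIV" "h meromorphic_on UNIV"
        by (auto simp: mero_eq_def)
      have "\<forall>\<^sub>\<approx>z. f z * deriv (\<lambda>z. g z + h z) z - (g z + h z) * deriv f z =
          f z * deriv g z - g z * deriv f z + (f z * deriv h z - h z * deriv f z)"
        using m(2,3)[THEN eventually_field_differentiable_cosparse]
        by eventually_elim (simp add: algebra_simps)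
      with m show "mero_eq (\<lambda>z. f z * deriv (\<lambda>z. g z + h z) z - (g z + h z) * deriv f z)
          (\<lambda>z. f z * deriv g z - g z * deriv f z + (f z * deriv h z - h z * deriv f z))"
        by (auto simp: mero_eq_def intro!: meromorphic_intros)
    qed
  next
    fix r y
    show "vf_bracket x (r *\<^sub>R y) = r *\<^sub>R vf_bracket x y"
    proof transfer
      fix f g and r :: real
      assume "mero_eq f f" "mero_eq g g"
      then have m: "f meromorphic_on UNIV" "g meromorphic_on UNIV"
        by (auto simp: mero_eq_def)
      have "\<forall>\<^sub>\<approx>z. f z * deriv (\<lambda>z. r *\<^sub>R g z) z - r *\<^sub>R g z * deriv f z =
          r *\<^sub>R (f z * deriv g z - g z * deriv f z)"
        using eventually_field_differentiable_cosparse[OF m(2)]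
        by eventually_elim (simp add: scaleR_conv_of_real algebra_simps)
      with m show "mero_eq (\<lambda>z. f z * deriv (\<lambda>z. r *\<^sub>R g z) z - r *\<^sub>R g z * deriv f z)
          (\<lambda>z. r *\<^sub>R (f z * deriv g z - g z * deriv f z))"
        by (auto simp: mero_eq_def intro!: meromorphic_intros)
    qed
  qed
  moreover from this have "linear (\<lambda>y. vf_bracket y x)" for x
    by (subst vf_bracket_antisym) (auto intro: linear_compose_neg)
  ultimately show ?thesis by (simp add: bilinear_def)
qed


section \<open>Jacobi elliptic functions\<close>

text \<open>Removing a discrete closed set from the plane leaves an open connected set, on which
  \<open>f\<close> is constant. The point \<open>a\<close> may itself have been removed, so
  continuity is what identifies the constant with \<open>f a\<close>.\<close>

lemma cosparse_deriv_zero_imp_const: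
  fixes f :: "complex \<Rightarrow> complex"
  assumes "\<forall>\<^sub>\<approx>z. (f has_field_derivative 0) (at z)" and "isCont f a"
  shows "\<forall>\<^sub>\<approx>z. f z = f a"
proof -
  define X where "X = {z. \<not> (f has_field_derivative 0) (at z)}"
  have X: "X sparse_in UNIV"
    using assms(1) by (simp add: eventually_cosparse X_def)
  have "open (- X)"
    using sparse_in_UNIV_imp_closed[OF X] by (simp add: open_Compl)
  moreover have "connected (- X)"
    using sparse_imp_connected[of UNIV X] X by (simp add: Compl_eq_Diff_UNIV connected_UNIV)
  moreover have D: "(f has_field_derivative 0) (at z)" if "z \<in> - X" for z
    using that by (simp add: X_def)
  then have "continuous_on (- X) f"
    by (intro continuous_at_imp_continuous_on ballI) (rule DERIV_isCont)
  ultimately obtain c where c: "\<And>z. z \<in> - X \<Longrightarrow> f z = c"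
    using DERIV_zero_connected_constant[of "- X" "{}" f] D by blast
  have ev: "\<forall>\<^sub>\<approx>z. f z = c"
    using eventually_not_in_cosparse[OF X] by eventually_elim (simp add: c)
  then have "eventually (\<lambda>z. f z = c) (at a)"
    by (rule eventually_cosparse_imp_eventually_at) auto
  then have "(f \<longlongrightarrow> c) (at a)" by (rule tendsto_eventually)
  with assms(2) have "f a = c"
    unfolding isCont_def by (rule LIM_unique)
  with ev show ?thesis by simp
qed

lemma jacobi_elliptic_squares:
  assumes "jacobi_elliptic k sn cn dn"
  shows "\<forall>\<^sub>\<approx>z. (sn z)\<^sup>2 + (cn z)\<^sup>2 = 1" "\<forall>\<^sub>\<approx>z. (dn z)\<^sup>2 + k\<^sup>2 * (sn z)\<^sup>2 = 1"
proof -
  from assms have d: "\<forall>\<^sub>\<approx>z. (sn has_field_derivative cn z * dn z) (at z)"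
      "\<forall>\<^sub>\<approx>z. (cn has_field_derivative - sn z * dn z) (at z)"
      "\<forall>\<^sub>\<approx>z. (dn has_field_derivative - k\<^sup>2 * sn z * cn z) (at z)"
    and v: "sn 0 = 0" "cn 0 = 1" "dn 0 = 1"
    and c: "isCont sn 0" "isCont cn 0" "isCont dn 0"
    by (auto simp: jacobi_elliptic_def intro!: analytic_at_imp_isCont)
  have "\<forall>\<^sub>\<approx>z. ((\<lambda>z. (sn z)\<^sup>2 + (cn z)\<^sup>2) has_field_derivative 0) (at z)"
    using d by eventually_elim (auto intro!: derivative_eq_intros simp: algebra_simps)
  from cosparse_deriv_zero_imp_const[OF this, of 0] v c
  show "\<forall>\<^sub>\<approx>z. (sn z)\<^sup>2 + (cn z)\<^sup>2 = 1" by (simp add: continuous_intros)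
  have "\<forall>\<^sub>\<approx>z. ((\<lambda>z. (dn z)\<^sup>2 + k\<^sup>2 * (sn z)\<^sup>2) has_field_derivative 0) (at z)"
    using d by eventually_elim (auto intro!: derivative_eq_intros simp: algebra_simps)
  from cosparse_deriv_zero_imp_const[OF this, of 0] v c
  show "\<forall>\<^sub>\<approx>z. (dn z)\<^sup>2 + k\<^sup>2 * (sn z)\<^sup>2 = 1" by (simp add: continuous_intros)
qed

text \<open>Apart from the factor \<open>a * b\<close>, the brackets are
  \<open>- dn (sn^2 + cn^2)\<close>, \<open>- cn (dn^2 + k^2 sn^2)\<close> and
  \<open>sn (dn^2 - k^2 cn^2)\<close>. The two quadratic identities together turn the last
  parenthesis into \<open>1 - k^2\<close>.\<close>

lemma vf_bracket_jacobi_elliptic: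
  assumes je: "jacobi_elliptic k sn cn dn"
  shows "vf_bracket (ddz (\<lambda>z. a * sn z)) (ddz (\<lambda>z. b * cn z)) = ddz (\<lambda>z. - (a * b) * dn z)"
    and "vf_bracket (ddz (\<lambda>z. a * sn z)) (ddz (\<lambda>z. b * dn z)) = ddz (\<lambda>z. - (a * b) * cn z)"
    and "vf_bracket (ddz (\<lambda>z. a * cn z)) (ddz (\<lambda>z. b * dn z)) = ddz (\<lambda>z. a * b * (1 - k\<^sup>2) * sn z)"
proof -
  from je have m: "sn meromorphic_on UNIV" "cn meromorphic_on UNIV" "dn meromorphic_on UNIV"
    and d: "\<forall>\<^sub>\<approx>z. (sn has_field_derivative cn z * dn z) (at z)"
      "\<forall>\<^sub>\<approx>z. (cn has_field_derivative - sn z * dn z) (at z)"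
      "\<forall>\<^sub>\<approx>z. (dn has_field_derivative - k\<^sup>2 * sn z * cn z) (at z)"
    by (auto simp: jacobi_elliptic_def)
  note sq = jacobi_elliptic_squares[OF je]
  have d': "\<forall>\<^sub>\<approx>z. ((\<lambda>z. c * sn z) has_field_derivative c * (cn z * dn z)) (at z)"
    "\<forall>\<^sub>\<approx>z. ((\<lambda>z. c * cn z) has_field_derivative c * (- sn z * dn z)) (at z)"
    "\<forall>\<^sub>\<approx>z. ((\<lambda>z. c * dn z) has_field_derivative c * (- k\<^sup>2 * sn z * cn z)) (at z)" for c
    by (rule eventually_mono[OF d(1)] eventually_mono[OF d(2)] eventually_mono[OF d(3)],
        erule DERIV_cmult)+
  have m': "(\<lambda>z. c * sn z) meromorphic_on UNIV" "(\<lambda>z. c * cn z) meromorphic_on UNIV"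
    "(\<lambda>z. c * dn z) meromorphic_on UNIV" for c
    using m by (auto intro!: meromorphic_intros)
  show "vf_bracket (ddz (\<lambda>z. a * sn z)) (ddz (\<lambda>z. b * cn z)) = ddz (\<lambda>z. - (a * b) * dn z)"
  proof (rule vf_bracket_ddz[OF m'(1) m'(2) m'(3) d'(1) d'(2)])
    show "\<forall>\<^sub>\<approx>z. a * sn z * (b * (- sn z * dn z)) - b * cn z * (a * (cn z * dn z)) =
        - (a * b) * dn z"
      using sq(1) by eventually_elim algebra
  qed
  show "vf_bracket (ddz (\<lambda>z. a * sn z)) (ddz (\<lambda>z. b * dn z)) = ddz (\<lambda>z. - (a * b) * cn z)"
  proof (rule vf_bracket_ddz[OF m'(1) m'(3) m'(2) d'(1) d'(3)])
    show "\<forall>\<^sub>\<approx>z. a * sn z * (b * (- k\<^sup>2 * sn z * cn z)) - b * dn z * (a * (cn z * dn z)) =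
        - (a * b) * cn z"
      using sq(2) by eventually_elim algebra
  qed
  show "vf_bracket (ddz (\<lambda>z. a * cn z)) (ddz (\<lambda>z. b * dn z)) = ddz (\<lambda>z. a * b * (1 - k\<^sup>2) * sn z)"
  proof (rule vf_bracket_ddz[OF m'(2) m'(3) m'(1) d'(2) d'(3)])
    show "\<forall>\<^sub>\<approx>z. a * cn z * (b * (- k\<^sup>2 * sn z * cn z)) - b * dn z * (a * (- sn z * dn z)) =
        a * b * (1 - k\<^sup>2) * sn z"
      using sq by eventually_elim algebra
  qed
qed

section \<open>The four Cayley-Klein triples\<close>

theorem mainTheorem2:
  fixes \<gamma> \<omega> :: real and sn cn dn :: "complex \<Rightarrow> complex"
  assumes "0 < \<gamma>" and "\<gamma> < 1"
    and "\<omega> = sqrt (1 - \<gamma>\<^sup>2)"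
    and "jacobi_elliptic (of_real \<gamma>) sn cn dn"
  shows
    "(let J = ddz (\<lambda>z. - dn z / of_real \<omega>);
          P1 = ddz (\<lambda>z. \<i> * cn z / of_real \<omega>);
          P2 = ddz (\<lambda>z. \<i> * sn z);
          A = (\<i> / of_real \<omega>) *\<^sub>\<complex> sigma1 \<gamma>;
          B = \<i> *\<^sub>\<complex> sigma2 \<gamma>;
          C = (- \<i> / of_real \<omega>) *\<^sub>\<complex> sigma3 \<gamma>
      in elliptic_CK vf_bracket J P1 P2 \<and>
         (\<exists>h. linear_map_on (span {A, B, C}) h \<and> h A = J \<and> h B = P1 \<and> h C = P2 \<and>
              (\<forall>h'. linear_map_on (span {A, B, C}) h' \<and> h' A = J \<and> h' B = P1 \<and> h' C = P2
                    \<longrightarrow> (\<forall>x \<in> span {A, B, C}. h' x = h x)) \<and>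
              real_lie_algebra_iso (span {A, B, C}) commutator (span {J, P1, P2}) vf_bracket h))
     \<and> hyperbolic_CK vf_bracket
         (ddz (\<lambda>z. - dn z / of_real \<omega>)) (ddz (\<lambda>z. cn z / of_real \<omega>)) (ddz sn)
     \<and> co_hyperbolic_CK vf_bracket
         (ddz (\<lambda>z. cn z / of_real \<omega>)) (ddz (\<lambda>z. dn z / of_real \<omega>)) (ddz sn)
     \<and> doubly_hyperbolic_CK vf_bracket
         (ddz sn) (ddz (\<lambda>z. - \<i> * dn z / of_real \<omega>)) (ddz (\<lambda>z. \<i> * cn z / of_real \<omega>))"
proof -
  \<comment> \<open>Absorbing constants into a coefficient turns every bracket into a multiplication
    rule for complex numbers.\<close>
  define S C D where "S = (\<lambda>c. ddz (\<lambda>z. c * sn z))" and "C = (\<lambda>c. ddz (\<lambda>z. c * cn z))"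
    and "D = (\<lambda>c. ddz (\<lambda>z. c * dn z))"
  define w where "w = complex_of_real \<omega>"
  have "\<gamma>\<^sup>2 < 1"
    using assms(1,2) by (simp add: power_less_one_iff)
  then have \<omega>: "\<omega>\<^sup>2 = 1 - \<gamma>\<^sup>2" "\<omega> \<noteq> 0"
    using assms(3) by simp_all
  then have w: "1 - (of_real \<gamma>)\<^sup>2 = w\<^sup>2" "w \<noteq> 0"
    by (simp_all add: w_def flip: of_real_power)
  have m: "sn meromorphic_on UNIV" "cn meromorphic_on UNIV" "dn meromorphic_on UNIV"
    and dn: "dn analytic_on {0}" "dn 0 = 1"
    using assms(4) by (auto simp: jacobi_elliptic_def)
  have SC: "vf_bracket (S a) (C b) = D (- (a * b))"
    and SD: "vf_bracket (S a) (D b) = C (- (a * b))"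
    and CD: "vf_bracket (C a) (D b) = S (a * b * w\<^sup>2)" for a b
    using vf_bracket_jacobi_elliptic[OF assms(4), of a b]
    by (simp_all add: S_def C_def D_def w)
  have neg: "- S a = S (- a)" "- C a = C (- a)" "- D a = D (- a)" for a
    using m by (simp_all add: S_def C_def D_def uminus_ddz meromorphic_on_mult meromorphic_on_const)
  have CS: "vf_bracket (C a) (S b) = D (a * b)"
    and DS: "vf_bracket (D a) (S b) = C (a * b)"
    and DC: "vf_bracket (D a) (C b) = S (- (a * b * w\<^sup>2))" for a b
    using vf_bracket_antisym[of "C a" "S b"] vf_bracket_antisym[of "D a" "S b"] vf_bracket_antisym[of "D a" "C b"]
    by (simp_all add: SC SD CD neg mult.commute)
  have norm: "ddz sn = S 1" "ddz (\<lambda>z. \<i> * sn z) = S \<i>"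
    "ddz (\<lambda>z. cn z / of_real \<omega>) = C (1 / w)" "ddz (\<lambda>z. \<i> * cn z / of_real \<omega>) = C (\<i> / w)"
    "ddz (\<lambda>z. dn z / of_real \<omega>) = D (1 / w)" "ddz (\<lambda>z. - dn z / of_real \<omega>) = D (- 1 / w)"
    "ddz (\<lambda>z. - \<i> * dn z / of_real \<omega>) = D (- \<i> / w)"
    by (simp_all add: S_def C_def D_def w_def)
  note brackets = SC CS SD DS CD DC neg
  \<comment> \<open>The factor \<open>w^2\<close> in the bracket of \<open>D\<close> with
    \<open>C\<close> cancels the two denominators \<open>w\<close>.\<close>
  have ell: "elliptic_CK vf_bracket (D (- 1 / w)) (C (\<i> / w)) (S \<i>)"
    using w(2) by (simp add: elliptic_CK_def brackets power2_eq_square)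
  \<comment> \<open>The coefficient of \<open>J\<close> takes the nonzero value
    \<open>- 1 / w\<close> at \<open>0\<close>, because \<open>dn 0 = 1\<close>.\<close>
  have "isCont (\<lambda>z. - 1 / w * dn z) 0"
    using dn(1) by (intro continuous_intros analytic_at_imp_isCont)
  then have J: "D (- 1 / w) \<noteq> 0"
    unfolding D_def using w(2) m dn(2)
    by (intro ddz_nonzero) (auto intro!: meromorphic_intros)
  have A: "(\<i> / of_real \<omega>) *\<^sub>\<complex> sigma1 \<gamma> \<noteq> 0"
    using \<omega>(2) by (intro sigma1_multiple_nonzero) simp
  obtain h where h:
    "real_lie_algebra_iso
       (span {(\<i> / of_real \<omega>) *\<^sub>\<complex> sigma1 \<gamma>, \<i> *\<^sub>\<complex> sigma2 \<gamma>, (- \<i> / of_real \<omega>) *\<^sub>\<complex> sigma3 \<gamma>}) commutator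
       (span {D (- 1 / w), C (\<i> / w), S \<i>}) vf_bracket h"
    "h ((\<i> / of_real \<omega>) *\<^sub>\<complex> sigma1 \<gamma>) = D (- 1 / w)" "h (\<i> *\<^sub>\<complex> sigma2 \<gamma>) = C (\<i> / w)"
    "h ((- \<i> / of_real \<omega>) *\<^sub>\<complex> sigma3 \<gamma>) = S \<i>"
    by (rule elliptic_CK_span_iso[OF bilinear_commutator commutator_self elliptic_CK_sigma[OF \<omega>]
          A bilinear_vf_bracket vf_bracket_self ell J])
  then have lin: "linear_map_on (span {(\<i> / of_real \<omega>) *\<^sub>\<complex> sigma1 \<gamma>, \<i> *\<^sub>\<complex> sigma2 \<gamma>,
      (- \<i> / of_real \<omega>) *\<^sub>\<complex> sigma3 \<gamma>}) h"
    by (simp add: real_lie_algebra_iso_def)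
  \<comment> \<open>Dividing \<open>P1\<close> and \<open>P2\<close> of the elliptic triple by
    \<open>\<i>\<close> preserves the first two relations and flips the sign of the third, which
    gives the hyperbolic case. The other two triples permute the functions and follow from the same
    table of brackets.\<close>
  have "hyperbolic_CK vf_bracket (D (- 1 / w)) (C (1 / w)) (S 1)"
    "co_hyperbolic_CK vf_bracket (C (1 / w)) (D (1 / w)) (S 1)"
    "doubly_hyperbolic_CK vf_bracket (S 1) (D (- \<i> / w)) (C (\<i> / w))"
    using w(2) by (simp_all add: hyperbolic_CK_def co_hyperbolic_CK_def doubly_hyperbolic_CK_def
        brackets power2_eq_square)
  note rel = ell this
  have uniq: "h' x = h x"
    if "linear_map_on (span {A, B, C}) h'" "linear_map_on (span {A, B, C}) h"
      "h' A = h A" "h' B = h B" "h' C = h C" "x \<in> span {A, B, C}"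
    for h' and h :: "complex^2^2 \<Rightarrow> mero_vf" and A B C x
    by (rule linear_map_on_span_unique[OF that(1,2) _ that(6)]) (use that(3-5) in blast)
  show ?thesis
    unfolding Let_def norm
  proof (intro conjI exI[of _ h] allI impI ballI; (elim conjE)?)
    fix h' x
    assume "linear_map_on (span {(\<i> / of_real \<omega>) *\<^sub>\<complex> sigma1 \<gamma>, \<i> *\<^sub>\<complex> sigma2 \<gamma>,
        (- \<i> / of_real \<omega>) *\<^sub>\<complex> sigma3 \<gamma>}) h'"
      and "x \<in> span {(\<i> / of_real \<omega>) *\<^sub>\<complex> sigma1 \<gamma>, \<i> *\<^sub>\<complex> sigma2 \<gamma>,
        (- \<i> / of_real \<omega>) *\<^sub>\<complex> sigma3 \<gamma>}"
      and "h' ((\<i> / of_real \<omega>) *\<^sub>\<complex> sigma1 \<gamma>) = D (- 1 / w)" "h' (\<i> *\<^sub>\<complex> sigma2 \<gamma>) = C (\<i> / w)"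
        "h' ((- \<i> / of_real \<omega>) *\<^sub>\<complex> sigma3 \<gamma>) = S \<i>"
    then show "h' x = h x"
      using uniq lin h(2-4) by metis
  qed (fact rel h lin)+
qed

end
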